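(* Let $f\in\mathcal{C}_{\mathcal{B}}$. Then $|H_2(3)|\leq \frac{1}{576}$. This bound is sharp, that is, there exists $f\in\mathcal{C}_{\mathcal{B}}$ for which equality holds.
   Context: Let $\mathbb{D}=\{z\in\mathbb{C}:|z|<1\}$. Let $\mathcal{A}$ be the class of analytic functions $f$ on $\mathbb{D}$ of the form $f(z)=z+\sum_{n=2}^{\infty}a_nz^n$. For analytic functions $h,g$ on $\mathbb{D}$, $h\prec g$ ($h$ is subordinate to $g$) means that there is an analytic function $w$ on $\mathbb{D}$ with $w(0)=0$ and $|w(z)|\le |z|$ (a Schwarz function) such that $h(z)=g(w(z))$ for $z \in \mathbb{D}$. The class $\mathcal{C}_{\mathcal{B}}$ is $$\mathcal{C}_{\mathcal{B}}=\left\{f\in\mathcal{A}:\ 1+\frac{zf''(z)}{f'(z)}\prec\sqrt{1+\tanh z}\right\},$$ where the branch of the square root is the one with value $1$ at $z=0$. For $f(z)=z+\sum_{n=2}^{\infty}a_nz^n\in\mathcal{A}$, the second Hankel determinant $H_2(3)$ is $H_2(3)=a_3a_5-a_4^2$. *)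

theory Defs
  imports "HOL-Complex_Analysis.Complex_Analysis"
begin

abbreviation unit_disc :: "complex set" where
  "unit_disc \<equiv> ball 0 1"

definition taylor_coeff :: "(complex \<Rightarrow> complex) \<Rightarrow> nat \<Rightarrow> complex" where
  "taylor_coeff f n = fps_nth (fps_expansion f 0) n"

text \<open>
  Functions are total, but only their values on the disc matter.
  Lemma \<open>class_A_expansion\<close> below recovers the form \<open>f z = z + (\<Sum>n\<ge>2. a\<^sub>n z\<^sup>n)\<close>.
\<close>

definition class_A :: "(complex \<Rightarrow> complex) set" where
  "class_A = {f. f holomorphic_on unit_disc \<and> taylor_coeff f 0 = 0 \<and> taylor_coeff f 1 = 1}"

definition schwarz_function :: "(complex \<Rightarrow> complex) \<Rightarrow> bool" where
  "schwarz_function w \<longleftrightarrow>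
     w holomorphic_on unit_disc \<and> w 0 = 0 \<and> (\<forall>z\<in>unit_disc. norm (w z) \<le> norm z)"

definition subordinate :: "(complex \<Rightarrow> complex) \<Rightarrow> (complex \<Rightarrow> complex) \<Rightarrow> bool"
    (infix "\<prec>" 50) where
  "h \<prec> g \<longleftrightarrow> h holomorphic_on unit_disc \<and> g holomorphic_on unit_disc \<and>
     (\<exists>w. schwarz_function w \<and> (\<forall>z\<in>unit_disc. h z = g (w z)))"

text \<open>
  On the unit disc \<open>1 + tanh z\<close> avoids the closed negative real axis, so the principal root
  \<^const>\<open>csqrt\<close> is the holomorphic branch with value \<open>1\<close> at \<open>0\<close>; see \<open>phi_B_branch\<close>.
\<close>

definition phi_B :: "complex \<Rightarrow> complex" where
  "phi_B z = csqrt (1 + tanh z)"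

text \<open>
  The condition \<open>deriv f z \<noteq> 0\<close> is implicit in the requirement that
  \<open>1 + z f''(z) / f'(z)\<close> be analytic on the disc; it is stated because \<open>x / 0 = 0\<close> in HOL.
\<close>

definition class_C_B :: "(complex \<Rightarrow> complex) set" where
  "class_C_B = {f \<in> class_A. (\<forall>z\<in>unit_disc. deriv f z \<noteq> 0) \<and>
     (\<lambda>z. 1 + z * deriv (deriv f) z / deriv f z) \<prec> phi_B}"

definition H2_3 :: "(complex \<Rightarrow> complex) \<Rightarrow> complex" where
  "H2_3 f = taylor_coeff f 3 * taylor_coeff f 5 - (taylor_coeff f 4)\<^sup>2"

lemma class_A_expansion:
  assumes "f \<in> class_A" "z \<in> unit_disc"
  shows "(\<lambda>n. taylor_coeff f (n + 2) * z ^ (n + 2)) sums (f z - z)"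
proof -
  have "(\<lambda>n. taylor_coeff f n * z ^ n) sums f z"
    using holomorphic_power_series[of f 0 1 z] assms
    by (simp add: class_A_def taylor_coeff_def fps_expansion_def)
  then have "(\<lambda>n. taylor_coeff f (n + 2) * z ^ (n + 2)) sums
      (f z - (\<Sum>i<2. taylor_coeff f i * z ^ i))"
    by (rule sums_split_initial_segment)
  then show ?thesis
    using assms by (simp add: class_A_def numeral_2_eq_2)
qed

lemma one_plus_tanh_disc:
  fixes z :: complex
  assumes "z \<in> unit_disc"
  shows "cosh z \<noteq> 0" and "1 + tanh z \<notin> \<real>\<^sub>\<le>\<^sub>0"
proof -
  define u where "u = exp (- (2 * z))"
  have im: "\<bar>Im (2 * z)\<bar> < pi"
    using assms abs_Im_le_cmod[of z] pi_gt3 by simp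
  have u: "u \<notin> \<real>\<^sub>\<le>\<^sub>0"
  proof
    assume "u \<in> \<real>\<^sub>\<le>\<^sub>0"
    moreover have "Ln u = - (2 * z)"
      unfolding u_def using im by (intro Ln_exp) auto
    moreover have "u \<noteq> 0" by (simp add: u_def)
    ultimately have "Re u < 0" "Im u = 0"
      by (auto simp: complex_nonpos_Reals_iff complex_eq_iff order_less_le)
    then have "Im (Ln u) = pi"
      using \<open>u \<noteq> 0\<close> Im_Ln_eq_pi by blast
    with \<open>Ln u = - (2 * z)\<close> im show False by simp
  qed
  have nz: "1 + u \<noteq> 0"
  proof
    assume "1 + u = 0"
    then have "u = - 1" by (simp add: eq_neg_iff_add_eq_0 add.commute)
    with u show False by simp
  qed
  have c: "cosh z = exp z * (1 + u) / 2"
    by (simp add: cosh_field_def u_def distrib_left flip: exp_add)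
  have s: "sinh z = exp z * (1 - u) / 2"
    by (simp add: sinh_field_def u_def right_diff_distrib flip: exp_add)
  show "cosh z \<noteq> 0" unfolding c using nz by simp
  have eq: "1 + tanh z = 2 / (1 + u)"
  proof -
    have "tanh z = (1 - u) / (1 + u)"
      unfolding tanh_def c s by simp
    with nz show ?thesis by (simp add: add_divide_eq_iff)
  qed
  show "1 + tanh z \<notin> \<real>\<^sub>\<le>\<^sub>0"
  proof
    assume "1 + tanh z \<in> \<real>\<^sub>\<le>\<^sub>0"
    then obtain r where r: "2 / (1 + u) = of_real r" "r \<le> 0"
      unfolding eq by (auto elim: nonpos_Reals_cases)
    from r nz have "r \<noteq> 0" by auto
    with r nz have "u = of_real (2 / r - 1)"
      by (simp add: field_simps)
    moreover have "2 / r - 1 \<le> 0"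
      using r(2) by (simp add: divide_nonneg_nonpos order_trans[of _ 0])
    ultimately show False using u by (metis nonpos_Reals_of_real_iff)
  qed
qed

lemma phi_B_branch:
  shows "phi_B holomorphic_on unit_disc" "phi_B 0 = 1" "(phi_B z)\<^sup>2 = 1 + tanh z"
proof -
  have "(\<lambda>z::complex. 1 + tanh z) holomorphic_on unit_disc"
    unfolding tanh_def sinh_field_def cosh_field_def
    using one_plus_tanh_disc(1) [unfolded cosh_field_def]
    by (intro holomorphic_intros) auto
  then show "phi_B holomorphic_on unit_disc"
    unfolding phi_B_def [abs_def] using one_plus_tanh_disc(2)
    by (intro holomorphic_on_csqrt') auto
qed (simp_all add: phi_B_def)

end

theory Submission imports Defs begin

text \<open>
  Let \<open>w\<close> be the Schwarz function of \<open>f \<in> class_C_B\<close> and \<open>c\<^sub>k\<close> its coefficients. The relations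
  \<open>h f' = f' + z f''\<close>, \<open>h\<^sup>2 = 1 + t\<close> and \<open>t' = (1 - t\<^sup>2) w'\<close> for \<open>t = tanh \<circ> w\<close> and \<open>h = \<phi> \<circ> w\<close>
  determine \<open>a\<^sub>3\<close>, \<open>a\<^sub>4\<close>, \<open>a\<^sub>5\<close>, and so \<open>576 H\<^sub>2(3)\<close>, as polynomials in \<open>c\<^sub>1, \<dots>, c\<^sub>4\<close>. After the
  triangle inequality, the Bessel inequality \<open>\<Sum> |c\<^sub>k|\<^sup>2 \<le> 1\<close> is the only information about \<open>w\<close>
  that the bound needs; it is attained for \<open>w z = z\<^sup>3\<close>, where only \<open>c\<^sub>3\<close> survives.
\<close>

section \<open>The real inequality for the majorant\<close>

text \<open>Weighted AM-GM splits the mixed products so that, apart from terms with a factor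
  \<open>a\<close>, the total is at most \<open>b + c + D\<^sup>2\<close>. The terms with that
  factor add at most \<open>a\<close>, and \<open>a + b + c + D\<^sup>2 \<le> 1\<close>
  finishes.\<close>

lemma hankel_majorant_le_one:
  fixes A B C D :: real
  assumes nonneg: "0 \<le> A" "0 \<le> B" "0 \<le> C" "0 \<le> D"
    and S: "A\<^sup>2 + B\<^sup>2 + C\<^sup>2 + D\<^sup>2 \<le> 1"
  shows "3/5 * (4 * B + A\<^sup>2) * (D/2 + A*C/12 + 5*A\<^sup>2*B/12 + 11*A^4/288)
           + (C + A*B/4 + 13*A^3/48)\<^sup>2 \<le> 1"
proof -
  define a b c where "a = A\<^sup>2" "b = B\<^sup>2" "c = C\<^sup>2"
  have abc: "0 \<le> a" "0 \<le> b" "0 \<le> c" "a + b + c + D\<^sup>2 \<le> 1"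
    using S by (auto simp: a_b_c_def)
  have le: "a \<le> 1" "b \<le> 1" "a + b + c \<le> 1" using abc zero_le_power2[of D] by linarith+
  have D: "D * (12/10 * B + 3/10 * a) \<le> D\<^sup>2 + (6/10*B + 15/100*a)\<^sup>2"
    using zero_le_power2[of "D - (6/10*B + 15/100*a)"]
    by (simp add: power2_eq_square algebra_simps)
  have ABC: "7/10 * (A*B*C) \<le> 2/10 * b + 6125/10000 * (a*c)"
    using zero_le_power2[of "2/10 * B - 35/100 * (A * C)"]
    by (simp add: a_b_c_def power2_eq_square algebra_simps)
  have AC: "71/120 * (A*C) \<le> 1/2*a + 1752/10000*c"
  proof -
    have "71/120 * (A*C) \<le> 1/2*a + (71/120)\<^sup>2/2*c"
      using zero_le_power2[of "A - 71/120 * C"]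
      by (simp add: a_b_c_def power2_eq_square algebra_simps)
    moreover have "(71/120)\<^sup>2/2*c \<le> 1752/10000*c"
      using abc by (intro mult_right_mono) (auto simp: power2_eq_square)
    ultimately show ?thesis by linarith
  qed
  \<comment> \<open>What remains once the terms without a factor \<open>a\<close> are absorbed by \<open>b\<close>, \<open>c\<close> and \<open>D\<^sup>2\<close>, divided by \<open>a\<close>.\<close>
  have key: "18/100*B + 225/10000*a + 6125/10000*c + 6225/10000*b + (1/2*a + 1752/10000*c)
      + 229/480 * (a * B) + 1109/11520 * a \<le> 1"
  \<comment> \<open>The coefficient of \<open>c\<close> is 7877/10000 in all, and 16893/100000 is,
    rounded down, what the coefficient of \<open>a\<close> can gain without exceeding it. Below this
    threshold the term in \<open>a * B\<close> fits into that gain and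
    \<open>a + b + c \<le> 1\<close> suffices.\<close>
  proof (cases "229/480 * B \<le> 16893/100000")
    case True
    then have "a * (229/480 * B) \<le> a * (16893/100000)"
      using abc by (intro mult_left_mono)
    then show ?thesis using True le abc by (simp add: field_simps)
  next
    case False
    \<comment> \<open>Only the excess over the threshold is estimated by
      \<open>a \<le> 1 - b\<close>, which leads to a cubic in \<open>B\<close>.\<close>
    then have "a * (229/480 * B - 16893/100000) \<le> (1 - b) * (229/480 * B - 16893/100000)"
      using le abc by (intro mult_right_mono) auto
    \<comment> \<open>Tangent to \<open>B\<^sup>3\<close> at \<open>0.68\<close>, close to the maximum of the resulting cubic in \<open>B\<close>.\<close>
    moreover have "b * B \<ge> 13872/10000 * B - 628864/1000000"
    proof -
      have "0 \<le> (B - 68/100)\<^sup>2 * (B + 136/100)" using nonneg by simp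
      also have "\<dots> = b * B - 13872/10000 * B + 628864/1000000"
        by (simp add: a_b_c_def power2_eq_square field_simps)
      finally show ?thesis by simp
    qed
    moreover have "a * (229/480 * B - 16893/100000) = 229/480 * (a * B) - 16893/100000 * a"
      by (simp add: algebra_simps)
    moreover have "(1 - b) * (229/480 * B - 16893/100000)
        = 229/480 * B - 16893/100000 - 229/480 * (b * B) + 16893/100000 * b"
      by (simp add: field_simps)
    ultimately show ?thesis using le abc nonneg by linarith
  qed
  have "3/5 * (4 * B + A\<^sup>2) * (D/2 + A*C/12 + 5*A\<^sup>2*B/12 + 11*A^4/288)
           + (C + A*B/4 + 13*A^3/48)\<^sup>2
      = c + D * (12/10 * B + 3/10 * a) + 7/10 * (A*B*C) + 17/16 * (a*b) + a * (71/120 * (A*C))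
        + 229/480 * (a*a*B) + 1109/11520 * (a*a*a)"
    by (simp add: a_b_c_def power2_eq_square power3_eq_cube power4_eq_xxxx field_simps)
  also have "\<dots> \<le> 1"
  proof -
    have "a * (71/120 * (A*C)) \<le> a * (1/2*a + 1752/10000*c)"
      using AC abc by (intro mult_left_mono) auto
    moreover have "a * (18/100*B + 225/10000*a + 6125/10000*c + 6225/10000*b + (1/2*a + 1752/10000*c)
        + 229/480 * (a * B) + 1109/11520 * a) \<le> a * 1"
      using key abc by (intro mult_left_mono) auto
    moreover have "a * a * a \<le> a * a * 1" using abc le by (intro mult_left_mono) auto
    \<comment> \<open>Applied to 44/100 of \<open>17/16 * (a*b)\<close>, as \<open>key\<close> takes
      the other 6225/10000. The coefficient of \<open>b\<close> becomes 36/100 + 20/100 + 44/100 =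
      1.\<close>
    moreover have "a * b \<le> b" using abc le by (simp add: mult_left_le_one_le)
    moreover have "(6/10*B + 15/100*a)\<^sup>2 = 36/100 * b + 18/100 * (a*B) + 225/10000 * (a*a)"
      by (simp add: a_b_c_def power2_eq_square algebra_simps)
    ultimately show ?thesis using D ABC abc by (simp add: algebra_simps)
  qed
  finally show ?thesis .
qed

section \<open>Bessel's inequality for Taylor coefficients\<close>

text \<open>Cauchy's formula for the k-th derivative on the circle of radius r. Writing the
  reciprocal of \<open>cis\<close> as a conjugate turns it into a Fourier coefficient, ready to be
  paired with a conjugated polynomial.\<close>

lemma has_integral_circle_coeff:
  assumes "f holomorphic_on ball 0 1" "0 < r" "r < 1"
  shows "((\<lambda>t. f (of_real r * cis (2*pi*t)) * cnj (cis (2*pi*t) ^ k))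
           has_integral of_real r ^ k * fps_nth (fps_expansion f 0) k) {0..1}"
proof -
  have sub: "cball 0 r \<subseteq> ball (0::complex) 1" using assms by auto
  have "((\<lambda>u. f u / (u-0) ^ Suc k) has_contour_integral
      ((2 * pi * \<i>) / (fact k) * (deriv ^^ k) f 0)) (circlepath 0 r)"
    using assms sub ball_subset_cball[of "0::complex" r]
    by (intro Cauchy_has_contour_integral_higher_derivative_circlepath)
       (auto intro!: holomorphic_on_imp_continuous_on intro: holomorphic_on_subset)
  then have I: "((\<lambda>t. f (circlepath 0 r t) / circlepath 0 r t ^ Suc k
        * vector_derivative (circlepath 0 r) (at t within {0..1}))
      has_integral (2 * pi * \<i>) / (fact k) * (deriv ^^ k) f 0) {0..1}"
    by (simp add: has_contour_integral_def)
  have E: "exp (2 * complex_of_real pi * \<i> * complex_of_real t) = cis (2*pi*t)" for t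
    by (simp add: cis_conv_exp mult_ac)
  have eq: "f (circlepath 0 r t) / circlepath 0 r t ^ Suc k
        * vector_derivative (circlepath 0 r) (at t within {0..1})
     = (2 * pi * \<i>) / of_real r ^ k * (f (of_real r * cis (2*pi*t)) * cnj (cis (2*pi*t) ^ k))"
    if "t \<in> {0..1}" for t
  proof -
    have "cnj (cis x ^ k) = 1 / cis x ^ k" for x
      by (simp add: cis_cnj divide_inverse cis_inverse flip: power_inverse)
    moreover have "vector_derivative (circlepath 0 r) (at t within {0..1}) = 2 * pi * \<i> * r * cis (2*pi*t)"
      using that by (simp add: vector_derivative_circlepath01 E)
    moreover have "circlepath 0 r t = r * cis (2*pi*t)"
      by (simp add: circlepath E)
    ultimately show ?thesis
      using \<open>r > 0\<close> by (simp add: field_simps power_mult_distrib)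
  qed
  have "((\<lambda>t. (2 * pi * \<i>) / of_real r ^ k * (f (of_real r * cis (2*pi*t)) * cnj (cis (2*pi*t) ^ k)))
      has_integral (2 * pi * \<i>) / (fact k) * (deriv ^^ k) f 0) {0..1}"
    by (rule has_integral_eq[OF eq I])
  from has_integral_mult_right[OF this, of "of_real r ^ k / (2 * pi * \<i>)"] show ?thesis
    using \<open>r > 0\<close> by (simp add: fps_expansion_def field_simps)
qed

text \<open>On |z| = r the partial sum P is the L2 projection of f, so the pairings of f with P and
  of P with P both equal \<open>S r\<close>. Integrating 2 Re (f conj P) - |P|^2 = |f|^2 - |f - P|^2
  \<le> 1 gives \<open>S r \<le> 1\<close>, and then r tends to 1.\<close>

lemma coeff_square_sum_le:
  assumes hol: "f holomorphic_on ball 0 1"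
    and bnd: "\<And>z. z \<in> ball 0 1 \<Longrightarrow> cmod (f z) \<le> 1"
  shows "(\<Sum>k<n. (cmod (fps_nth (fps_expansion f 0) k))\<^sup>2) \<le> 1"
proof -
  define c where "c = fps_nth (fps_expansion f 0)"
  define S where "S = (\<lambda>r::real. \<Sum>k<n. (cmod (c k) * r^k)\<^sup>2)"
  have le: "S r \<le> 1" if r: "0 < r" "r < 1" for r
  proof -
    define e where "e = (\<lambda>t. cis (2*pi*t))"
    define F where "F = (\<lambda>t. f (of_real r * e t))"
    define P where "P = (\<lambda>z. \<Sum>k<n. c k * z ^ k)"
    define Q where "Q = (\<lambda>t. P (of_real r * e t))"
    have holP: "P holomorphic_on ball 0 1"
      unfolding P_def by (intro holomorphic_intros)
    have cP: "fps_nth (fps_expansion P 0) k = c k" if "k < n" for k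
    proof -
      have "P has_fps_expansion (\<Sum>k<n. fps_const (c k) * fps_X ^ k)"
        unfolding P_def by (intro fps_expansion_intros)
      moreover have "P has_fps_expansion fps_expansion P 0"
        unfolding P_def by (intro analytic_at_imp_has_fps_expansion_0 analytic_intros)
      ultimately have "fps_expansion P 0 = (\<Sum>k<n. fps_const (c k) * fps_X ^ k)"
        using fps_expansion_unique_complex by blast
      then show ?thesis using that
        by (simp add: fps_sum_nth fps_X_power_nth if_distrib sum.If_cases cong: if_cong)
    qed
    \<comment> \<open>Only the first \<open>n\<close> coefficients of \<open>g\<close> enter, so one
      computation serves both \<open>f\<close> and \<open>P\<close>.\<close>
    have int: "((\<lambda>t. g (of_real r * e t) * cnj (Q t)) has_integral of_real (S r)) {0..1}"
      if g: "g holomorphic_on ball 0 1" "\<And>k. k < n \<Longrightarrow> fps_nth (fps_expansion g 0) k = c k" for g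
    proof -
      have "((\<lambda>t. \<Sum>k<n. cnj (c k) * of_real r ^ k * (g (of_real r * e t) * cnj (e t ^ k)))
        has_integral (\<Sum>k<n. cnj (c k) * of_real r ^ k * (of_real r ^ k * fps_nth (fps_expansion g 0) k))) {0..1}"
        unfolding e_def using has_integral_circle_coeff[OF g(1) r]
        by (intro has_integral_sum has_integral_mult_right) auto
      moreover have "(\<Sum>k<n. cnj (c k) * of_real r ^ k * (of_real r ^ k * fps_nth (fps_expansion g 0) k))
         = of_real (S r)"
      proof -
        have norm_sq: "complex_of_real ((cmod (c k) * r^k)\<^sup>2) = c k * cnj (c k) * (of_real r ^ k)\<^sup>2" for k
          unfolding power_mult_distrib of_real_mult complex_norm_square by simp
        show ?thesis
          unfolding S_def of_real_sum norm_sq using g(2)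
          by (intro sum.cong) (simp_all add: power2_eq_square mult_ac)
      qed
      moreover have "(\<lambda>t. \<Sum>k<n. cnj (c k) * of_real r ^ k * (g (of_real r * e t) * cnj (e t ^ k)))
         = (\<lambda>t. g (of_real r * e t) * cnj (Q t))"
        by (simp add: Q_def P_def sum_distrib_left power_mult_distrib mult_ac)
      ultimately show ?thesis by simp
    qed
    have i1: "((\<lambda>t. F t * cnj (Q t)) has_integral of_real (S r)) {0..1}"
      unfolding F_def by (rule int[OF hol]) (simp add: c_def)
    have i2: "((\<lambda>t. Q t * cnj (Q t)) has_integral of_real (S r)) {0..1}"
      by (subst (1) Q_def) (rule int[OF holP cP])
    have "((\<lambda>t. 2 * (F t * cnj (Q t)) - Q t * cnj (Q t)) has_integral 2 * of_real (S r) - of_real (S r)) {0..1}"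
      by (intro has_integral_diff has_integral_mult_right i1 i2)
    from has_integral_Re[OF this]
    have I: "((\<lambda>t. Re (2 * (F t * cnj (Q t)) - Q t * cnj (Q t))) has_integral S r) {0..1}"
      by simp
    have "Re (2 * (F t * cnj (Q t)) - Q t * cnj (Q t)) \<le> 1" for t
    proof -
      have "cmod (F t) \<le> 1"
        unfolding F_def e_def using r by (intro bnd) (auto simp: norm_mult)
      then have "(cmod (F t))\<^sup>2 \<le> 1" by (simp add: power_le_one_iff)
      moreover have "0 \<le> (cmod (F t - Q t))\<^sup>2" by simp
      ultimately show ?thesis
        unfolding cmod_power2 by (simp add: power2_eq_square algebra_simps)
    qed
    then show ?thesis
      using has_integral_le[OF I has_integral_const_real[of 1 0 1]] by simp
  qed
  \<comment> \<open>The unit circle lies outside the domain, but \<open>S\<close> is a polynomial in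
    r, so the bound passes to its left limit at 1.\<close>
  have "(S \<longlongrightarrow> S 1) (at_left 1)" unfolding S_def by (intro tendsto_intros)
  moreover have "\<forall>\<^sub>F r in at_left 1. S r \<le> 1"
    using eventually_at_left_real[OF zero_less_one] by eventually_elim (auto intro: le)
  ultimately have "S 1 \<le> 1"
    by (intro tendsto_upperbound) auto
  then show ?thesis by (simp add: S_def c_def)
qed

section \<open>The Hankel determinant in terms of the Schwarz coefficients\<close>

text \<open>Comparing coefficients yields \<open>T\<close>, then \<open>H\<close>, then
  \<open>F\<close>, each coefficient from earlier ones. The fourth coefficient of \<open>f\<close>
  carries a factor 1/24, so 576 = 24^2 normalises its square. Being exact, the formula serves the
  bound and the extremal function alike.\<close>

lemma H2_3_subordinate:
  fixes f w :: "complex \<Rightarrow> complex"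
  assumes f: "f \<in> class_A" and nz: "\<forall>z\<in>unit_disc. deriv f z \<noteq> 0"
    and w: "schwarz_function w"
    and eq: "\<forall>z\<in>unit_disc. 1 + z * deriv (deriv f) z / deriv f z = phi_B (w z)"
  defines "c \<equiv> taylor_coeff w"
  shows "576 * H2_3 f =
     3/5 * (4 * c 2 + c 1 ^ 2) * (c 4 / 2 + c 1 * c 3 / 12 - 5 * c 1 ^ 2 * c 2 / 12 - 11 * c 1 ^ 4 / 288)
     - (c 3 + c 1 * c 2 / 4 - 13 * c 1 ^ 3 / 48)\<^sup>2"
proof -
  define h t where "h = (\<lambda>z. phi_B (w z))" and "t = (\<lambda>z. tanh (w z))"
  define F W H T where "F = fps_expansion f 0" and "W = fps_expansion w 0"
    and "H = fps_expansion h 0" and "T = fps_expansion t 0"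
  have wu: "w z \<in> unit_disc" if "z \<in> unit_disc" for z
    using w that unfolding schwarz_function_def by force
  have holw: "w holomorphic_on unit_disc" and w0: "w 0 = 0"
    using w by (auto simp: schwarz_function_def)
  have holh: "h holomorphic_on unit_disc"
    unfolding h_def
    using holomorphic_on_compose_gen[OF holw phi_B_branch(1)] wu by (simp add: o_def image_subset_iff)
  have derw: "(w has_field_derivative deriv w z) (at z)" if "z \<in> unit_disc" for z
    using holomorphic_derivI[OF holw _ that] by simp
  have dert: "(t has_field_derivative (1 - t z ^ 2) * deriv w z) (at z)" if "z \<in> unit_disc" for z
    unfolding t_def using one_plus_tanh_disc(1)[OF wu[OF that]] derw[OF that]
    by (auto intro!: derivative_eq_intros)
  have holt: "t holomorphic_on unit_disc"
    using dert by (subst holomorphic_on_open) (simp, blast)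
  have E: "f has_fps_expansion F" "w has_fps_expansion W" "h has_fps_expansion H" "t has_fps_expansion T"
    using f holw holh holt
    by (auto simp: class_A_def F_def W_def H_def T_def intro!: has_fps_expansion_fps_expansion[of unit_disc])
  have near: "\<forall>\<^sub>F z in nhds (0::complex). z \<in> unit_disc"
    by (intro eventually_nhds_in_open) auto
  have unique: "G1 = G2" if "g1 has_fps_expansion G1" "g2 has_fps_expansion G2"
    "\<And>z. z \<in> unit_disc \<Longrightarrow> g1 z = g2 z" for g1 g2 :: "complex \<Rightarrow> complex" and G1 G2
  proof -
    have "\<forall>\<^sub>F z in nhds 0. g1 z = g2 z" using near by eventually_elim (use that in auto)
    then show ?thesis
      using that(1,2) has_fps_expansion_cong[of g1 g2] fps_expansion_unique_complex by blast
  qed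
  have hf: "h z * deriv f z = deriv f z + z * deriv (deriv f) z" if "z \<in> unit_disc" for z
    using eq nz that by (auto simp: h_def field_simps dest!: bspec[of _ _ z])
  \<comment> \<open>Clearing the quotient, squaring away the root and using tanh' = 1 - tanh^2 give
    identities polynomial in the series and their derivatives, so no series has to be
    composed.\<close>
  have eq1: "H * fps_deriv F = fps_deriv F + fps_X * fps_deriv (fps_deriv F)"
    by (rule unique[of "\<lambda>z. h z * deriv f z" _ "\<lambda>z. deriv f z + z * deriv (deriv f) z"])
       (auto intro!: fps_expansion_intros E simp: hf)
  have h2: "h z ^ 2 = 1 + t z" for z
    using phi_B_branch(3) by (simp add: h_def t_def)
  have eq2: "H ^ 2 = 1 + T"
    by (rule unique[OF _ _ h2]) (auto intro!: fps_expansion_intros E)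
  have eq3: "fps_deriv T = (1 - T ^ 2) * fps_deriv W"
    by (rule unique[of "deriv t" _ "\<lambda>z. (1 - t z ^ 2) * deriv w z"])
       (use dert[THEN DERIV_imp_deriv] in \<open>auto intro!: fps_expansion_intros E\<close>)
  have c: "c n = fps_nth W n" for n by (simp add: c_def taylor_coeff_def W_def)
  have a: "taylor_coeff f n = fps_nth F n" for n by (simp add: taylor_coeff_def F_def)
  have T0: "fps_nth T 0 = 0" and H0: "fps_nth H 0 = 1" and W0: "fps_nth W 0 = 0"
    using w0 phi_B_branch(2) by (simp_all add: T_def H_def W_def fps_expansion_def t_def h_def)
  have F1: "fps_nth F (Suc 0) = 1" using f by (simp add: class_A_def a)
  note [simp] = T0 H0 W0 F1
  note ex = fps_mult_nth power2_eq_square numeral_eq_Suc fps_numeral_nth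
  \<comment> \<open>Differentiation shifts the index: coefficient n - 1 of \<open>eq3\<close>
    expresses n times the n-th coefficient of \<open>T\<close> through \<open>c\<close> and earlier
    coefficients of \<open>T\<close>.\<close>
  have T1: "fps_nth T 1 = c 1"
    using arg_cong[OF eq3, of "\<lambda>G. fps_nth G 0"] by (simp add: c ex)
  have T2: "fps_nth T 2 = c 2"
    using arg_cong[OF eq3, of "\<lambda>G. fps_nth G 1"] by (simp add: c ex)
  have "fps_nth T 3 = c 3 - fps_nth T 1 * fps_nth T 1 * c 1 / 3"
    using arg_cong[OF eq3, of "\<lambda>G. fps_nth G 2"] by (simp add: c ex field_simps)
  also have "\<dots> = c 3 - c 1 ^ 3 / 3"
    unfolding T1 by (simp add: field_simps power2_eq_square power3_eq_cube power4_eq_xxxx)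
  finally have T3: "fps_nth T 3 = c 3 - c 1 ^ 3 / 3" .
  have "fps_nth T 4 = (4 * c 4 - 2 * fps_nth T 1 * fps_nth T 1 * c 2 - 2 * fps_nth T 1 * fps_nth T 2 * c 1) / 4"
    using arg_cong[OF eq3, of "\<lambda>G. fps_nth G 3"] by (simp add: c ex field_simps)
  also have "\<dots> = c 4 - c 1 ^ 2 * c 2"
    unfolding T1 T2 by (simp add: field_simps power2_eq_square power3_eq_cube power4_eq_xxxx)
  finally have T4: "fps_nth T 4 = c 4 - c 1 ^ 2 * c 2" .
  \<comment> \<open>As \<open>H\<close> has constant term 1, coefficient n of \<open>eq2\<close>
    contains the n-th coefficient of \<open>H\<close> exactly twice, besides products of earlier
    ones.\<close>
  have "fps_nth H 1 = fps_nth T 1 / 2"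
    using arg_cong[OF eq2, of "\<lambda>G. fps_nth G 1"] by (simp add: c ex field_simps)
  also have "\<dots> = c 1 / 2"
    unfolding T1 by (simp add: field_simps power2_eq_square power3_eq_cube power4_eq_xxxx)
  finally have H1: "fps_nth H 1 = c 1 / 2" .
  have "fps_nth H 2 = (fps_nth T 2 - fps_nth H 1 * fps_nth H 1) / 2"
    using arg_cong[OF eq2, of "\<lambda>G. fps_nth G 2"] by (simp add: c ex field_simps)
  also have "\<dots> = c 2 / 2 - c 1 ^ 2 / 8"
    unfolding H1 T2 by (simp add: field_simps power2_eq_square power3_eq_cube power4_eq_xxxx)
  finally have H2: "fps_nth H 2 = c 2 / 2 - c 1 ^ 2 / 8" .
  have "fps_nth H 3 = (fps_nth T 3 - 2 * fps_nth H 1 * fps_nth H 2) / 2"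
    using arg_cong[OF eq2, of "\<lambda>G. fps_nth G 3"] by (simp add: c ex field_simps)
  also have "\<dots> = c 3 / 2 - c 1 * c 2 / 4 - 5 / 48 * c 1 ^ 3"
    unfolding H1 H2 T3 by (simp add: field_simps power2_eq_square power3_eq_cube power4_eq_xxxx)
  finally have H3: "fps_nth H 3 = c 3 / 2 - c 1 * c 2 / 4 - 5 / 48 * c 1 ^ 3" .
  have "fps_nth H 4 = (fps_nth T 4 - 2 * fps_nth H 1 * fps_nth H 3 - fps_nth H 2 * fps_nth H 2) / 2"
    using arg_cong[OF eq2, of "\<lambda>G. fps_nth G 4"] by (simp add: c ex field_simps)
  also have "\<dots> = c 4 / 2 - c 1 * c 3 / 4 - c 2 ^ 2 / 8 - 5 / 16 * c 1 ^ 2 * c 2 + 17 / 384 * c 1 ^ 4"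
    unfolding H1 H2 H3 T4 by (simp add: field_simps power2_eq_square power3_eq_cube power4_eq_xxxx)
  finally have H4: "fps_nth H 4 = c 4 / 2 - c 1 * c 3 / 4 - c 2 ^ 2 / 8 - 5 / 16 * c 1 ^ 2 * c 2 + 17 / 384 * c 1 ^ 4" .
  \<comment> \<open>By \<open>H0\<close> the terms of \<open>fps_deriv F\<close> cancel in
    \<open>eq1\<close>, and coefficient n - 1 gives n (n - 1) times the n-th coefficient of
    \<open>F\<close>: hence the divisors 2, 6, 12, 20.\<close>
  have "fps_nth F 2 = fps_nth H 1 / 2"
    using arg_cong[OF eq1, of "\<lambda>G. fps_nth G 1"] by (simp add: c ex field_simps)
  also have "\<dots> = c 1 / 4"
    unfolding H1 by (simp add: field_simps power2_eq_square power3_eq_cube power4_eq_xxxx)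
  finally have F2: "fps_nth F 2 = c 1 / 4" .
  have "fps_nth F 3 = (2 * fps_nth H 1 * fps_nth F 2 + fps_nth H 2) / 6"
    using arg_cong[OF eq1, of "\<lambda>G. fps_nth G 2"] by (simp add: c ex field_simps)
  also have "\<dots> = c 2 / 12 + c 1 ^ 2 / 48"
    unfolding H1 H2 F2 by (simp add: field_simps power2_eq_square power3_eq_cube power4_eq_xxxx)
  finally have F3: "fps_nth F 3 = c 2 / 12 + c 1 ^ 2 / 48" .
  have "fps_nth F 4 = (3 * fps_nth H 1 * fps_nth F 3 + 2 * fps_nth H 2 * fps_nth F 2 + fps_nth H 3) / 12"
    using arg_cong[OF eq1, of "\<lambda>G. fps_nth G 3"] by (simp add: c ex field_simps)
  also have "\<dots> = (c 3 / 2 + c 1 * c 2 / 8 - 13 / 96 * c 1 ^ 3) / 12"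
    unfolding H1 H2 H3 F2 F3 by (simp add: field_simps power2_eq_square power3_eq_cube power4_eq_xxxx)
  finally have F4: "fps_nth F 4 = (c 3 / 2 + c 1 * c 2 / 8 - 13 / 96 * c 1 ^ 3) / 12" .
  have "fps_nth F 5 = (4 * fps_nth H 1 * fps_nth F 4 + 3 * fps_nth H 2 * fps_nth F 3 + 2 * fps_nth H 3 * fps_nth F 2 + fps_nth H 4) / 20"
    using arg_cong[OF eq1, of "\<lambda>G. fps_nth G 4"] by (simp add: c ex field_simps)
  also have "\<dots> = (c 4 / 2 + c 1 * c 3 / 12 - 5 / 12 * c 1 ^ 2 * c 2 - 11 / 288 * c 1 ^ 4) / 20"
    unfolding H1 H2 H3 H4 F2 F3 F4 by (simp add: field_simps power2_eq_square power3_eq_cube power4_eq_xxxx)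
  finally have F5: "fps_nth F 5 = (c 4 / 2 + c 1 * c 3 / 12 - 5 / 12 * c 1 ^ 2 * c 2 - 11 / 288 * c 1 ^ 4) / 20" .
  show ?thesis
    unfolding H2_3_def a F3 F4 F5 by (simp add: field_simps power2_eq_square)
qed

section \<open>Functions with a prescribed Schwarz function\<close>

lemma schwarz_function_power: "n > 0 \<Longrightarrow> schwarz_function (\<lambda>z. z ^ n)"
proof -
  assume "n > 0"
  then have "cmod (z ^ n) \<le> cmod z" if "z \<in> unit_disc" for z
    using that power_decreasing[of 1 n "cmod z"] by (simp add: norm_power)
  then show ?thesis
    using \<open>n > 0\<close> by (auto simp: schwarz_function_def intro!: holomorphic_intros)
qed

text \<open>Solve the differential equation: with \<open>z * q z = phi_B (w z) - 1\<close> it reads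
  f''/f' = q, so f' is the exponential of a primitive of q, hence free of zeros, and f is a
  primitive of f'. Both primitives exist on the convex disc.\<close>

lemma class_A_exists_phi_B:
  assumes w: "schwarz_function w"
  obtains f where "f \<in> class_A" "\<forall>z\<in>unit_disc. deriv f z \<noteq> 0"
    "\<forall>z\<in>unit_disc. 1 + z * deriv (deriv f) z / deriv f z = phi_B (w z)"
proof -
  let ?h = "\<lambda>z. phi_B (w z)"
  have wu: "w z \<in> unit_disc" if "z \<in> unit_disc" for z
    using w that unfolding schwarz_function_def by force
  have h0: "?h 0 = 1" using w phi_B_branch(2) by (simp add: schwarz_function_def)
  have "?h holomorphic_on unit_disc"
    using holomorphic_on_compose_gen[OF _ phi_B_branch(1), of w unit_disc] w wu
    by (simp add: o_def schwarz_function_def image_subset_iff)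
  \<comment> \<open>The divided difference of \<open>?h\<close> at 0, with the derivative as its
    value there, is holomorphic.\<close>
  from pole_lemma_open[OF this, of 0] obtain q where q: "q holomorphic_on unit_disc"
    "\<And>z. z * q z = ?h z - 1"
    using h0 by fastforce
  obtain g0 where "\<And>z. z \<in> unit_disc \<Longrightarrow> (g0 has_field_derivative q z) (at z within unit_disc)"
    using holomorphic_convex_primitive'[OF _ _ q(1)] by auto
  then have g0: "(g0 has_field_derivative q z) (at z)" if "z \<in> unit_disc" for z
    using that by (metis at_within_open open_ball)
  \<comment> \<open>Subtracting \<open>g0 0\<close> makes \<open>e 0 = 1\<close>, the normalisation
    of f' at 0.\<close>
  define e where "e = (\<lambda>z. exp (g0 z - g0 0))"
  have e: "(e has_field_derivative e z * q z) (at z)" if "z \<in> unit_disc" for z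
    unfolding e_def using g0[OF that] by (auto intro!: derivative_eq_intros)
  then have "e holomorphic_on unit_disc" by (subst holomorphic_on_open) (simp, blast)
  then obtain f0 where "\<And>z. z \<in> unit_disc \<Longrightarrow> (f0 has_field_derivative e z) (at z within unit_disc)"
    using holomorphic_convex_primitive'[of unit_disc e] by auto
  then have f0: "(f0 has_field_derivative e z) (at z)" if "z \<in> unit_disc" for z
    using that by (metis at_within_open open_ball)
  define f where "f = (\<lambda>z. f0 z - f0 0)"
  have f: "(f has_field_derivative e z) (at z)" if "z \<in> unit_disc" for z
    unfolding f_def using f0[OF that] by (auto intro!: derivative_eq_intros)
  have df: "deriv f z = e z" if "z \<in> unit_disc" for z
    using f[OF that] by (rule DERIV_imp_deriv)
  have ddf: "deriv (deriv f) z = e z * q z" if "z \<in> unit_disc" for z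
  proof -
    have "\<forall>\<^sub>F z in nhds z. z \<in> unit_disc"
      using that by (intro eventually_nhds_in_open) auto
    then have "\<forall>\<^sub>F z in nhds z. deriv f z = e z" by eventually_elim (rule df)
    then have "deriv (deriv f) z = deriv e z" by (rule deriv_cong_ev) simp
    then show ?thesis using DERIV_imp_deriv[OF e[OF that]] by simp
  qed
  have "f holomorphic_on unit_disc" using f by (subst holomorphic_on_open) (simp, blast)
  then have "f \<in> class_A"
    using df[of 0] by (simp add: class_A_def taylor_coeff_def fps_expansion_def f_def e_def)
  moreover have "1 + z * deriv (deriv f) z / deriv f z = ?h z" if "z \<in> unit_disc" for z
    using df[OF that] ddf[OF that] q(2)[of z] by (simp add: e_def)
  ultimately show ?thesis using df that by (simp add: e_def)
qed

text \<open>Discharges the holomorphy demanded by \<open>\<prec>\<close>, through the nonvanishing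
  derivative and \<open>phi_B_branch\<close>, so that a Schwarz function can be handled
  directly.\<close>

lemma class_C_B_iff:
  "f \<in> class_C_B \<longleftrightarrow> f \<in> class_A \<and> (\<forall>z\<in>unit_disc. deriv f z \<noteq> 0) \<and>
     (\<exists>w. schwarz_function w \<and> (\<forall>z\<in>unit_disc. 1 + z * deriv (deriv f) z / deriv f z = phi_B (w z)))"
proof -
  have "(\<lambda>z. 1 + z * deriv (deriv f) z / deriv f z) holomorphic_on unit_disc"
    if "f \<in> class_A" "\<forall>z\<in>unit_disc. deriv f z \<noteq> 0"
    using that by (auto simp: class_A_def intro!: holomorphic_intros holomorphic_deriv)
  then show ?thesis using phi_B_branch(1) by (auto simp: class_C_B_def subordinate_def)
qed

section \<open>The bound and its sharpness\<close>

theorem theorem3p2: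
  "(\<forall>f\<in>class_C_B. norm (H2_3 f) \<le> 1 / 576) \<and> (\<exists>f\<in>class_C_B. norm (H2_3 f) = 1 / 576)"
proof (intro conjI ballI)
  fix f assume "f \<in> class_C_B"
  then obtain w where f: "f \<in> class_A" "\<forall>z\<in>unit_disc. deriv f z \<noteq> 0" and w: "schwarz_function w"
    and eq: "\<forall>z\<in>unit_disc. 1 + z * deriv (deriv f) z / deriv f z = phi_B (w z)"
    by (auto simp: class_C_B_iff)
  define c where "c = taylor_coeff w"
  define A B C D where "A = cmod (c 1)" and "B = cmod (c 2)" and "C = cmod (c 3)" and "D = cmod (c 4)"
  \<comment> \<open>The five indices are 0 to 4; as \<open>c 0\<close> vanishes, \<open>c 1\<close>
    to \<open>c 4\<close> remain.\<close>
  have "(\<Sum>k<5. (cmod (fps_nth (fps_expansion w 0) k))\<^sup>2) \<le> 1"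
    using w by (intro coeff_square_sum_le) (force simp: schwarz_function_def)+
  moreover have "c 0 = 0"
    using w by (simp add: c_def taylor_coeff_def fps_expansion_def schwarz_function_def)
  ultimately have S: "A\<^sup>2 + B\<^sup>2 + C\<^sup>2 + D\<^sup>2 \<le> 1"
    by (simp add: A_def B_def C_def D_def c_def taylor_coeff_def eval_nat_numeral)
  have "576 * cmod (H2_3 f) = cmod (576 * H2_3 f)"
    by (simp add: norm_mult)
  also have "\<dots> \<le> 3/5 * cmod (4 * c 2 + c 1 ^ 2)
        * cmod (c 4 / 2 + c 1 * c 3 / 12 - 5 * c 1 ^ 2 * c 2 / 12 - 11 * c 1 ^ 4 / 288)
      + (cmod (c 3 + c 1 * c 2 / 4 - 13 * c 1 ^ 3 / 48))\<^sup>2"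
    unfolding H2_3_subordinate[OF f w eq, folded c_def]
    by (rule order_trans[OF norm_triangle_ineq4]) (simp only: norm_mult norm_power norm_divide norm_numeral order_refl)
  \<comment> \<open>All signs are given up here: each monomial is replaced by its modulus.\<close>
  also have "\<dots> \<le> 3/5 * (4 * B + A\<^sup>2) * (D/2 + A*C/12 + 5*A\<^sup>2*B/12 + 11*A^4/288)
      + (C + A*B/4 + 13*A^3/48)\<^sup>2"
  proof -
    note tri = norm_triangle_mono norm_triangle_ineq4[THEN order_trans] add_mono
    have "cmod (4 * c 2 + c 1 ^ 2) \<le> 4 * B + A\<^sup>2"
      by (intro norm_triangle_mono) (simp_all add: A_def B_def norm_mult norm_power)
    moreover have "cmod (c 4 / 2 + c 1 * c 3 / 12 - 5 * c 1 ^ 2 * c 2 / 12 - 11 * c 1 ^ 4 / 288)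
        \<le> D/2 + A*C/12 + 5*A\<^sup>2*B/12 + 11*A^4/288"
      by (intro tri)
        (simp_all add: A_def B_def C_def D_def norm_mult norm_power norm_divide)
    moreover have "cmod (c 3 + c 1 * c 2 / 4 - 13 * c 1 ^ 3 / 48) \<le> C + A*B/4 + 13*A^3/48"
      by (intro tri)
        (simp_all add: A_def B_def C_def D_def norm_mult norm_power norm_divide)
    ultimately show ?thesis
      by (intro add_mono mult_mono power_mono) (auto simp: A_def B_def)
  qed
  also have "\<dots> \<le> 1"
    using S by (intro hankel_majorant_le_one) (auto simp: A_def B_def C_def D_def)
  finally show "norm (H2_3 f) \<le> 1 / 576" by simp
next
  have w: "schwarz_function (\<lambda>z. z ^ 3)" by (rule schwarz_function_power) simp
  obtain f where f: "f \<in> class_A" "\<forall>z\<in>unit_disc. deriv f z \<noteq> 0"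
    "\<forall>z\<in>unit_disc. 1 + z * deriv (deriv f) z / deriv f z = phi_B (z ^ 3)"
    using class_A_exists_phi_B[OF w] .
  have "taylor_coeff (\<lambda>z. z ^ 3) n = (if n = 3 then 1 else 0)" for n
    unfolding taylor_coeff_def fps_expansion_eqI[OF has_fps_expansion_fps_X_power]
    by (simp add: fps_X_power_nth)
  \<comment> \<open>With \<open>c 3 = 1\<close> as the only nonzero coefficient, the product term
    vanishes and the square equals 1.\<close>
  then have "576 * H2_3 f = -1"
    using H2_3_subordinate[OF f(1,2) w f(3)] by simp
  then have "576 * cmod (H2_3 f) = 1"
    by (metis norm_minus_cancel norm_mult norm_numeral norm_one)
  moreover have "f \<in> class_C_B" using f w by (auto simp: class_C_B_iff)
  ultimately show "\<exists>f\<in>class_C_B. norm (H2_3 f) = 1 / 576"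
    by (intro bexI[of _ f]) simp_all
qed

end
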